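(* Let $q=p^n$ where $p$ is a prime, let $\theta$ be a primitive element of $GF(q)$, and let $k\geq 4$ and $r\geq 1$ be integers with $q-1=kr$. Let $B:=\langle\theta^r\rangle\subseteq GF(q)$. Then the orbit of $B$ under the action of $PGL(2,q)$ on the $k$-subsets of $X=GF(q)\cup\{\infty\}$ is (the block set of) a simple $3$-$(q+1,k,\lambda)$ design on $X$, where $$\lambda=\begin{cases}(k-1)(k-2)/2 & \text{if } k-1 \text{ does not divide } q,\\ 1 & \text{if } k-1 \text{ divides } q.\end{cases}$$
   Context: $PGL(2,q)$ is the group of maps $x\mapsto \frac{ax+b}{cx+d}$ on $X=GF(q)\cup\{\infty\}$ with $a,b,c,d\in GF(q)$, $ad-bc\neq 0$, with the usual conventions for $\infty$. $\langle\theta^r\rangle$ denotes the multiplicative subgroup of $GF(q)^*$ generated by $\theta^r$ (of order $k$). A $3$-$(v,k,\lambda)$ design is a pair $(X,\mathcal{B})$ with $|X|=v$ and $\mathcal{B}$ a collection of $k$-subsets (blocks) of $X$ such that every $3$-subset of $X$ lies in exactly $\lambda$ blocks; it is simple if $\mathcal{B}$ has no repeated blocks. *)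

theory Defs
  imports
    "HOL-Algebra.Group_Action"
    "HOL-Computational_Algebra.Primes"
    "HOL-Library.Cardinality"
    "HOL-Library.Multiset"
begin

text \<open>The field \<open>GF(q)\<close> is a type \<open>'a :: {field, finite}\<close>. The projective line
  \<open>GF(q) \<union> {\<infinity>}\<close> is \<open>'a option\<close>, with \<open>None\<close> as the point \<open>\<infinity>\<close>.\<close>

fun linear_fractional :: "'a::field \<Rightarrow> 'a \<Rightarrow> 'a \<Rightarrow> 'a \<Rightarrow> 'a option \<Rightarrow> 'a option" where
  "linear_fractional a b c d None = (if c = 0 then None else Some (a / c))"
| "linear_fractional a b c d (Some x) =
     (if c * x + d = 0 then None else Some ((a * x + b) / (c * x + d)))"

definition PGL2 :: "('a::field option \<Rightarrow> 'a option) monoid" where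
  "PGL2 = \<lparr>carrier = {linear_fractional a b c d | a b c d. a * d - b * c \<noteq> 0},
           monoid.mult = (\<circ>), one = id\<rparr>"

definition cyclic_subgroup :: "'a::field \<Rightarrow> 'a set" where
  "cyclic_subgroup g = {g powi i | i. True}"

definition primitive_element :: "'a::field \<Rightarrow> bool" where
  "primitive_element \<theta> \<longleftrightarrow> \<theta> \<noteq> 0 \<and> cyclic_subgroup \<theta> = UNIV - {0}"

text \<open>Blocks form a multiset, so that a design may a priori have repeated blocks.\<close>

definition is_3_design :: "nat \<Rightarrow> nat \<Rightarrow> nat \<Rightarrow> 'x set \<Rightarrow> 'x set multiset \<Rightarrow> bool" where
  "is_3_design v k l X \<B> \<longleftrightarrow>
     finite X \<and> card X = v \<and>
     (\<forall>b \<in># \<B>. b \<subseteq> X \<and> card b = k) \<and>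
     (\<forall>T. T \<subseteq> X \<and> card T = 3 \<longrightarrow> size {#b \<in># \<B>. T \<subseteq> b#} = l)"

definition simple_design :: "'x set multiset \<Rightarrow> bool" where
  "simple_design \<B> \<longleftrightarrow> (\<forall>b. count \<B> b \<le> 1)"

end

theory Submission
  imports Defs "HOL-Computational_Algebra.Polynomial"
begin

text \<open>Since \<open>PGL(2,q)\<close> is sharply 3-transitive, every triple of points lies in the same number \<open>\<lambda>\<close> of
  images of \<open>B\<close>, and \<open>\<lambda>\<close> times the order of the stabilizer of \<open>B\<close> is \<open>k (k - 1) (k - 2)\<close>. Here \<open>B\<close> is
  the group of \<open>k\<close>-th roots of unity, and \<open>x \<mapsto> (a x + b) / (c x + d)\<close> maps \<open>x \<in> B\<close> into \<open>B\<close> iff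
  \<open>(a x + b)\<^sup>k = (c x + d)\<^sup>k\<close>.

  If \<open>k - 1\<close> is a power of the characteristic, this condition is quadratic on \<open>B\<close>, so an image of \<open>B\<close>
  that meets \<open>B\<close> in three points equals \<open>B\<close>, and \<open>\<lambda> = 1\<close>.

  Otherwise \<open>k - 1 = s t\<close> with \<open>s\<close> a power of the characteristic and \<open>t \<ge> 2\<close> prime to it. An element
  of the stabilizer satisfies \<open>(a X + b)\<^sup>k - (c X + d)\<^sup>k = l (X\<^sup>k - 1)\<close> as polynomials. Differentiating,
  undoing the Frobenius map \<open>x \<mapsto> x\<^sup>s\<close>, differentiating again and comparing both identities at the root
  of one of the linear forms shows that the matrix is diagonal or antidiagonal. So the stabilizer is
  dihedral of order \<open>2 k\<close>.\<close>

section \<open>Sharp 3-transitivity of the projective linear group\<close>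

text \<open>Homogeneous coordinates: on nonzero vectors a linear fractional map becomes a
  matrix-vector product, with no case split on \<infinity> or zero denominators. The zero vector
  also yields \<open>None\<close>, hence the nonvanishing conditions below.\<close>

definition proj_point :: "'a::field \<Rightarrow> 'a \<Rightarrow> 'a option" where
  "proj_point x y = (if y = 0 then None else Some (x / y))"

lemma proj_point_cases:
  obtains x y :: "'a::field" where "z = proj_point x y" "x \<noteq> 0 \<or> y \<noteq> 0"
proof (cases z)
  case None
  then show ?thesis using that[of 1 0] by (simp add: proj_point_def)
next
  case (Some u)
  then show ?thesis using that[of u 1] by (simp add: proj_point_def)
qed

lemma linear_fractional_proj_point:
  fixes a b c d x y :: "'a::field"
  assumes "x \<noteq> 0 \<or> y \<noteq> 0"
  shows "linear_fractional a b c d (proj_point x y) = proj_point (a * x + b * y) (c * x + d * y)"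
proof (cases "y = 0")
  case True
  then show ?thesis using assms by (simp add: proj_point_def)
next
  case False
  have "c * (x / y) + d = (c * x + d * y) / y" "a * (x / y) + b = (a * x + b * y) / y"
    using False by (simp_all add: field_simps)
  then show ?thesis using False by (simp add: proj_point_def)
qed

lemma linear_map_nonzero:
  fixes a b c d x y :: "'a::field"
  assumes "a * d - b * c \<noteq> 0" "x \<noteq> 0 \<or> y \<noteq> 0"
  shows "a * x + b * y \<noteq> 0 \<or> c * x + d * y \<noteq> 0"
proof (rule ccontr)
  assume "\<not> ?thesis"
  then have *: "a * x + b * y = 0" "c * x + d * y = 0" by auto
  have "(a * d - b * c) * x = d * (a * x + b * y) - b * (c * x + d * y)"
       "(a * d - b * c) * y = a * (c * x + d * y) - c * (a * x + b * y)"
    by (simp_all add: algebra_simps)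
  with * assms show False by simp
qed

text \<open>In homogeneous coordinates this is the matrix product. The determinant condition on the
  inner map keeps its output a nonzero vector.\<close>

lemma linear_fractional_comp:
  fixes a b c d a' b' c' d' :: "'a::field"
  assumes "a' * d' - b' * c' \<noteq> 0"
  shows "linear_fractional a b c d \<circ> linear_fractional a' b' c' d' =
    linear_fractional (a * a' + b * c') (a * b' + b * d') (c * a' + d * c') (c * b' + d * d')"
proof
  fix z :: "'a option"
  obtain x y where z: "z = proj_point x y" "x \<noteq> 0 \<or> y \<noteq> 0" by (rule proj_point_cases)
  show "(linear_fractional a b c d \<circ> linear_fractional a' b' c' d') z =
    linear_fractional (a * a' + b * c') (a * b' + b * d') (c * a' + d * c') (c * b' + d * d') z"
    using linear_map_nonzero[OF assms z(2)] z
    by (simp add: linear_fractional_proj_point algebra_simps)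
qed

section \<open>Group operations on linear fractional maps\<close>

lemma linear_fractional_scalar:
  fixes a :: "'a::field"
  assumes "a \<noteq> 0"
  shows "linear_fractional a 0 0 a = id"
proof
  fix z :: "'a option"
  show "linear_fractional a 0 0 a z = id z" using assms by (cases z) simp_all
qed

lemma PGL2_iff:
  "g \<in> carrier PGL2 \<longleftrightarrow> (\<exists>a b c d. g = linear_fractional a b c d \<and> a * d - b * c \<noteq> 0)"
  by (auto simp: PGL2_def)

lemma linear_fractional_in_PGL2:
  "a * d - b * c \<noteq> 0 \<Longrightarrow> linear_fractional a b c d \<in> carrier PGL2"
  unfolding PGL2_iff by blast

lemma id_in_PGL2: "id \<in> carrier (PGL2 :: ('a::field option \<Rightarrow> 'a option) monoid)"
  using linear_fractional_in_PGL2[of 1 1 0 "0::'a"] linear_fractional_scalar[of "1::'a"] by simp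

lemma comp_in_PGL2:
  fixes g h :: "'a::field option \<Rightarrow> 'a option"
  assumes "g \<in> carrier PGL2" "h \<in> carrier PGL2"
  shows "g \<circ> h \<in> carrier PGL2"
proof -
  obtain a b c d where g: "g = linear_fractional a b c d" "a * d - b * c \<noteq> 0"
    using assms(1) unfolding PGL2_iff by blast
  obtain a' b' c' d' where h: "h = linear_fractional a' b' c' d'" "a' * d' - b' * c' \<noteq> 0"
    using assms(2) unfolding PGL2_iff by blast
  have "(a * a' + b * c') * (c * b' + d * d') - (a * b' + b * d') * (c * a' + d * c')
      = (a * d - b * c) * (a' * d' - b' * c')"
    by (simp add: algebra_simps)
  with g(2) h(2) show ?thesis
    unfolding g(1) h(1) linear_fractional_comp[OF h(2)]
    by (intro linear_fractional_in_PGL2) simp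
qed

lemma PGL2_inverse:
  fixes g :: "'a::field option \<Rightarrow> 'a option"
  assumes "g \<in> carrier PGL2"
  obtains h where "h \<in> carrier PGL2" "h \<circ> g = id" "g \<circ> h = id"
proof -
  obtain a b c d where g: "g = linear_fractional a b c d" "a * d - b * c \<noteq> 0"
    using assms unfolding PGL2_iff by blast
  have det: "d * a - (- b) * (- c) \<noteq> 0" using g(2) by (simp add: algebra_simps)
  show ?thesis
  \<comment> \<open>The adjugate matrix: its product with the original is the determinant times the
    identity, and scalar matrices act trivially.\<close>
  proof (rule that[of "linear_fractional d (- b) (- c) a"])
    show "linear_fractional d (- b) (- c) a \<in> carrier PGL2"
      using det by (rule linear_fractional_in_PGL2)
    show "linear_fractional d (- b) (- c) a \<circ> g = id"
      unfolding g(1) linear_fractional_comp[OF g(2)]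
      using linear_fractional_scalar[OF g(2)] by (simp add: algebra_simps)
    show "g \<circ> linear_fractional d (- b) (- c) a = id"
      unfolding g(1) linear_fractional_comp[OF det]
      using linear_fractional_scalar[OF g(2)] by (simp add: algebra_simps)
  qed
qed

abbreviation inv_map :: "('a \<Rightarrow> 'b) \<Rightarrow> 'b \<Rightarrow> 'a" where
  "inv_map \<equiv> inv_into UNIV"

lemma bij_PGL2: "g \<in> carrier PGL2 \<Longrightarrow> bij g"
  by (erule PGL2_inverse) (rule o_bij)

lemma inv_in_PGL2:
  assumes "g \<in> carrier PGL2"
  shows "inv_map g \<in> carrier PGL2"
proof -
  obtain h where "h \<in> carrier PGL2" "h \<circ> g = id" "g \<circ> h = id"
    using assms by (rule PGL2_inverse)
  then show ?thesis by (simp add: inv_unique_comp)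
qed

lemma PGL2_to_standard_triple:
  fixes x y z :: "'a::field option"
  assumes "distinct [x, y, z]"
  obtains g where "g \<in> carrier PGL2" "g x = None" "g y = Some 0" "g z = Some 1"
proof -
  obtain f where f: "f \<in> carrier PGL2" "f x = None"
  proof (cases x)
    case None
    then show ?thesis using that[OF id_in_PGL2] by simp
  next
    case (Some u)
    \<comment> \<open>The instantiation follows the order \<open>a\<close>, \<open>d\<close>,
      \<open>b\<close>, \<open>c\<close> of the premise, so the map is
      \<open>x \<mapsto> 1 / (x - u)\<close>.\<close>
    then show ?thesis
      using that[OF linear_fractional_in_PGL2[of 0 "- u" 1 1]] by simp
  qed
  have "inj f" using bij_PGL2[OF f(1)] by (rule bij_is_inj)
  then have "f y \<noteq> f x" "f z \<noteq> f x" "f y \<noteq> f z"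
    using assms by (auto dest: injD)
  then obtain u v where uv: "f y = Some u" "f z = Some v" "u \<noteq> v"
    using f(2) by (metis option.exhaust)
  \<comment> \<open>The affine map \<open>w \<mapsto> (w - u) / (v - u)\<close> fixes \<infinity>
    and sends \<open>u\<close>, \<open>v\<close> to 0, 1.\<close>
  show ?thesis
  proof (rule that[of "linear_fractional 1 (- u) 0 (v - u) \<circ> f"])
    show "linear_fractional 1 (- u) 0 (v - u) \<circ> f \<in> carrier PGL2"
      using uv f(1) by (intro comp_in_PGL2 linear_fractional_in_PGL2) auto
  qed (use uv f in auto)
qed

lemma PGL2_fixing_standard_triple:
  assumes "g \<in> carrier PGL2" "g None = None" "g (Some 0) = Some 0" "g (Some 1) = Some 1"
  shows "g = id"
proof -
  obtain a b c d where g: "g = linear_fractional a b c d" "a * d - b * c \<noteq> 0"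
    using assms(1) unfolding PGL2_iff by blast
  have "c = 0" using assms(2) by (auto simp: g split: if_splits)
  moreover from this have "d \<noteq> 0" "a \<noteq> 0" using g(2) by auto
  moreover from calculation have "b = 0" using assms(3) by (auto simp: g)
  moreover from calculation have "a = d" using assms(4) by (auto simp: g)
  ultimately show ?thesis using linear_fractional_scalar[of a] by (simp add: g)
qed

lemma length_three_conv: "length xs = 3 \<longleftrightarrow> (\<exists>x y z. xs = [x, y, z])"
  by (auto simp: numeral_3_eq_3 length_Suc_conv)

text \<open>Both triples are carried to \<infinity>, 0, 1. Uniqueness holds because only the
  identity fixes these three points.\<close>

lemma PGL2_sharply_3_transitive:
  fixes xs ys :: "'a::field option list"
  assumes "length xs = 3" "distinct xs" "length ys = 3" "distinct ys"
  shows "\<exists>!g. g \<in> carrier PGL2 \<and> map g xs = ys"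
proof -
  obtain x1 x2 x3 where xs: "xs = [x1, x2, x3]" using assms(1) unfolding length_three_conv by blast
  obtain y1 y2 y3 where ys: "ys = [y1, y2, y3]" using assms(3) unfolding length_three_conv by blast
  obtain f where f: "f \<in> carrier PGL2" "f x1 = None" "f x2 = Some 0" "f x3 = Some 1"
    using assms(2) unfolding xs by (rule PGL2_to_standard_triple)
  obtain e where e: "e \<in> carrier PGL2" "e y1 = None" "e y2 = Some 0" "e y3 = Some 1"
    using assms(4) unfolding ys by (rule PGL2_to_standard_triple)
  have inj: "inj e" "inj f" using bij_PGL2 e(1) f(1) bij_is_inj by blast+
  have inv_e: "inv_map e None = y1" "inv_map e (Some 0) = y2" "inv_map e (Some 1) = y3"
    using inv_f_f[OF inj(1)] e by metis+
  have inv_f: "inv_map f None = x1" "inv_map f (Some 0) = x2" "inv_map f (Some 1) = x3"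
    using inv_f_f[OF inj(2)] f by metis+
  show ?thesis
  proof (rule ex1I[of _ "inv_map e \<circ> f"])
    show "inv_map e \<circ> f \<in> carrier PGL2 \<and> map (inv_map e \<circ> f) xs = ys"
      using e(1) f inv_e by (simp add: comp_in_PGL2 inv_in_PGL2 xs ys)
  next
    fix g assume g: "g \<in> carrier PGL2 \<and> map g xs = ys"
    then have "e \<circ> g \<circ> inv_map f \<in> carrier PGL2"
      using e(1) f(1) by (simp add: comp_in_PGL2 inv_in_PGL2)
    then have "e \<circ> g \<circ> inv_map f = id"
      by (rule PGL2_fixing_standard_triple) (use g e inv_f in \<open>simp_all add: xs ys\<close>)
    then have *: "e (g (inv_map f w)) = w" for w by (metis comp_apply id_apply)
    show "g = inv_map e \<circ> f"
    proof
      fix w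
      have "e (g w) = f w" using *[of "f w"] inj(2) by simp
      then show "g w = (inv_map e \<circ> f) w" using inj(1) by (metis comp_apply inv_f_f)
    qed
  qed
qed

lemma PGL2_3_transitive:
  fixes S T :: "'a::field option set"
  assumes "card S = 3" "card T = 3"
  obtains g where "g \<in> carrier PGL2" "g ` S = T"
proof -
  have "finite S" "finite T" using assms card.infinite by fastforce+
  then obtain xs ys where "set xs = S" "distinct xs" "set ys = T" "distinct ys"
    by (metis finite_distinct_list)
  then show ?thesis
    using PGL2_sharply_3_transitive[of xs ys] assms that by (metis distinct_card image_set)
qed

section \<open>Blocks through three points\<close>

lemma orbit_PGL2_iff: "b \<in> orbit PGL2 (\<lambda>g. (`) g) B \<longleftrightarrow> (\<exists>g \<in> carrier PGL2. b = g ` B)"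
  by (auto simp: orbit_def)

lemma card_image_PGL2: "g \<in> carrier PGL2 \<Longrightarrow> card (g ` S) = card S"
  by (metis bij_PGL2 bij_is_inj card_image inj_on_subset subset_UNIV)

text \<open>Once \<open>T\<close> is enumerated, sharp 3-transitivity identifies the maps sending
  \<open>T\<close> into \<open>B\<close> with the lists of three distinct elements of
  \<open>B\<close>.\<close>

lemma card_PGL2_into:
  fixes B T :: "'a::{field, finite} option set"
  assumes T: "card T = 3" and B: "card B \<ge> 3"
  shows "card {h \<in> carrier PGL2. h ` T \<subseteq> B} = card B * (card B - 1) * (card B - 2)"
proof -
  obtain ts where ts: "set ts = T" "distinct ts" using finite_distinct_list[of T] by auto
  have len: "length ts = 3" using ts T by (metis distinct_card)
  let ?L = "{xs. length xs = 3 \<and> distinct xs \<and> set xs \<subseteq> B}"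
  have "bij_betw (\<lambda>h. map h ts) {h \<in> carrier PGL2. h ` T \<subseteq> B} ?L"
  proof (rule bij_betw_imageI)
    show "inj_on (\<lambda>h. map h ts) {h \<in> carrier PGL2. h ` T \<subseteq> B}"
    proof (rule inj_onI)
      fix g h assume gh: "g \<in> {h \<in> carrier PGL2. h ` T \<subseteq> B}" "h \<in> {h \<in> carrier PGL2. h ` T \<subseteq> B}"
        "map g ts = map h ts"
      have "distinct (map h ts)"
        using gh ts bij_PGL2[of h] by (auto simp: distinct_map bij_def intro: inj_on_subset)
      then have "\<exists>!f. f \<in> carrier PGL2 \<and> map f ts = map h ts"
        using PGL2_sharply_3_transitive[of ts "map h ts"] ts len by auto
      then show "g = h" using gh by blast
    qed
    show "(\<lambda>h. map h ts) ` {h \<in> carrier PGL2. h ` T \<subseteq> B} = ?L"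
    proof (intro equalityI subsetI)
      fix xs assume "xs \<in> (\<lambda>h. map h ts) ` {h \<in> carrier PGL2. h ` T \<subseteq> B}"
      then obtain h where h: "h \<in> carrier PGL2" "h ` T \<subseteq> B" "xs = map h ts" by blast
      have "inj_on h (set ts)" using bij_PGL2[OF h(1)] by (auto simp: bij_def intro: inj_on_subset)
      then show "xs \<in> ?L" using h ts len by (auto simp: distinct_map)
    next
      fix xs assume xs: "xs \<in> ?L"
      then obtain h where h: "h \<in> carrier PGL2" "map h ts = xs"
        using PGL2_sharply_3_transitive[of ts xs] ts len by auto
      moreover have "h ` T = set xs" using h ts by auto
      ultimately show "xs \<in> (\<lambda>h. map h ts) ` {h \<in> carrier PGL2. h ` T \<subseteq> B}"
        using xs by auto
    qed
  qed
  then have "card {h \<in> carrier PGL2. h ` T \<subseteq> B} = card ?L" by (rule bij_betw_same_card)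
  also have "\<dots> = \<Prod>{card B - 3 + 1..card B}" by (rule card_lists_distinct_length_eq) (use B in auto)
  also have "\<dots> = card B * (card B - 1) * (card B - 2)"
  proof -
    obtain m where "card B = m + 3" using B by (metis add.commute le_Suc_ex)
    then show ?thesis by (simp add: numeral_3_eq_3 atLeastAtMostSuc_conv algebra_simps)
  qed
  finally show ?thesis .
qed

text \<open>Double counting: the maps \<open>h\<close> sending \<open>T\<close> into
  \<open>B\<close> are sorted by the preimage of \<open>B\<close> under \<open>h\<close>. These
  preimages are exactly the blocks containing \<open>T\<close>, and each fibre is a coset of the
  stabilizer.\<close>

lemma card_blocks_times_stabilizer:
  fixes B T :: "'a::{field, finite} option set"
  assumes T: "card T = 3" and B: "card B \<ge> 3"
  shows "card {b \<in> orbit PGL2 (\<lambda>g. (`) g) B. T \<subseteq> b} * card {g \<in> carrier PGL2. g ` B = B}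
       = card B * (card B - 1) * (card B - 2)"
proof -
  let ?S = "{h \<in> carrier PGL2. h ` T \<subseteq> B}" and ?stab = "{g \<in> carrier PGL2. g ` B = B}"
  let ?blocks = "{b \<in> orbit PGL2 (\<lambda>g. (`) g) B. T \<subseteq> b}"
  have fibre: "card {h \<in> ?S. h -` B = b} = card ?stab" if b: "b \<in> ?blocks" for b
  proof -
    obtain g where g: "g \<in> carrier PGL2" "b = g ` B" using b by (auto simp: orbit_PGL2_iff)
    have bij: "bij g" using g(1) by (rule bij_PGL2)
    \<comment> \<open>For \<open>b\<close> the image of \<open>B\<close> under \<open>g\<close>, the
      preimage of \<open>B\<close> under \<open>h\<close> is \<open>b\<close> exactly when
      \<open>h \<circ> g\<close> stabilizes \<open>B\<close>.\<close>
    have "bij_betw (\<lambda>\<sigma>. \<sigma> \<circ> inv_map g) ?stab {h \<in> ?S. h -` B = b}"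
    proof (rule bij_betwI[where g = "\<lambda>h. h \<circ> g"])
      show "(\<lambda>\<sigma>. \<sigma> \<circ> inv_map g) \<in> ?stab \<rightarrow> {h \<in> ?S. h -` B = b}"
      proof
        fix \<sigma> assume s: "\<sigma> \<in> ?stab"
        then have inj: "inj \<sigma>" using bij_PGL2 bij_is_inj by blast
        have "\<sigma> -` B = B" using s inj by (metis (mono_tags, lifting) inj_vimage_image_eq mem_Collect_eq)
        then have "(\<sigma> \<circ> inv_map g) -` B = b"
          using bij g(2) by (simp add: vimage_comp[symmetric] bij_vimage_eq_inv_image bij_imp_bij_inv inv_inv_eq)
        moreover have "\<sigma> \<circ> inv_map g \<in> carrier PGL2"
          using s g(1) by (simp add: comp_in_PGL2 inv_in_PGL2)
        ultimately show "\<sigma> \<circ> inv_map g \<in> {h \<in> ?S. h -` B = b}" using b by auto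
      qed
      show "(\<lambda>h. h \<circ> g) \<in> {h \<in> ?S. h -` B = b} \<rightarrow> ?stab"
      proof
        fix h assume h: "h \<in> {h \<in> ?S. h -` B = b}"
        then have "surj h" using bij_PGL2 bij_is_surj by blast
        then have "h ` b = B" using h by (auto simp: surj_image_vimage_eq)
        then show "h \<circ> g \<in> ?stab" using h g by (auto simp: comp_in_PGL2 image_comp[symmetric])
      qed
    qed (use bij in \<open>auto simp: fun_eq_iff bij_is_inj bij_is_surj surj_f_inv_f\<close>)
    then show ?thesis by (simp add: bij_betw_same_card)
  qed
  have image: "(\<lambda>h. h -` B) ` ?S \<subseteq> ?blocks"
  proof
    fix b assume "b \<in> (\<lambda>h. h -` B) ` ?S"
    then obtain h where h: "h \<in> carrier PGL2" "h ` T \<subseteq> B" "b = h -` B" by blast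
    then have "b = inv_map h ` B" by (simp add: bij_PGL2 bij_vimage_eq_inv_image)
    then have "b \<in> orbit PGL2 (\<lambda>g. (`) g) B" using inv_in_PGL2[OF h(1)] by (auto simp: orbit_PGL2_iff)
    then show "b \<in> ?blocks" using h(2,3) by auto
  qed
  have "card ?S = (\<Sum>h\<in>?S. 1)" by simp
  also have "\<dots> = (\<Sum>b\<in>?blocks. \<Sum>h\<in>{h \<in> ?S. h -` B = b}. 1)"
    by (rule sum.group[symmetric]) (use image in auto)
  also have "\<dots> = (\<Sum>b\<in>?blocks. card ?stab)" by (rule sum.cong) (use fibre in simp_all)
  also have "\<dots> = card ?blocks * card ?stab" by simp
  finally show ?thesis using card_PGL2_into[OF assms] by simp
qed

text \<open>If two blocks contain \<open>T\<close>, the map pulling one of them back to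
  \<open>B\<close> takes the other to an image of \<open>B\<close> that meets \<open>B\<close> in at
  least three points; rigidity makes them equal.\<close>

lemma card_blocks_eq_1:
  fixes B T :: "'a::{field, finite} option set"
  assumes T: "card T = 3" and B: "card B \<ge> 3"
    and rigid: "\<And>g. g \<in> carrier PGL2 \<Longrightarrow> card (g ` B \<inter> B) \<ge> 3 \<Longrightarrow> g ` B = B"
  shows "card {b \<in> orbit PGL2 (\<lambda>g. (`) g) B. T \<subseteq> b} = 1"
proof -
  obtain S where "S \<subseteq> B" "card S = 3" using B by (metis obtain_subset_with_card_n)
  then obtain g where g: "g \<in> carrier PGL2" "T \<subseteq> g ` B"
    using PGL2_3_transitive[of S T] T by (metis image_mono)
  have "h ` B = g ` B" if h: "h \<in> carrier PGL2" "T \<subseteq> h ` B" for h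
  proof -
    have bij: "bij h" "bij g" using h g bij_PGL2 by auto
    have "inv_map h ` T \<subseteq> (inv_map h \<circ> g) ` B \<inter> B"
    proof -
      have "inv_map h ` T \<subseteq> inv_map h ` g ` B" "inv_map h ` T \<subseteq> inv_map h ` h ` B"
        using g h by (auto intro!: image_mono)
      then show ?thesis using bij by (simp add: bij_is_inj image_comp)
    qed
    moreover have "card (inv_map h ` T) = 3" using T h(1) by (simp add: card_image_PGL2 inv_in_PGL2)
    ultimately have "card ((inv_map h \<circ> g) ` B \<inter> B) \<ge> 3" by (metis card_mono finite)
    then have "(inv_map h \<circ> g) ` B = B"
      using h g by (intro rigid comp_in_PGL2 inv_in_PGL2) auto
    then have "h ` (inv_map h ` (g ` B)) = h ` B" by (simp add: image_comp)
    then show ?thesis using bij(1) by (simp add: image_f_inv_f bij_is_surj)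
  qed
  then have "{b \<in> orbit PGL2 (\<lambda>g. (`) g) B. T \<subseteq> b} = {g ` B}"
    using g unfolding orbit_PGL2_iff by blast
  then show ?thesis by simp
qed

section \<open>The stabilizer of the group of roots of unity\<close>

lemma prime_CHAR_finite_field: "prime CHAR('a::{field, finite})"
proof -
  have "CHAR('a) > 0" by (rule finite_imp_CHAR_pos) simp
  then show ?thesis by (rule prime_CHAR_semidom)
qed

text \<open>Translation by 1 permutes the field, so comparing the sums of all elements shows that
  the field size vanishes in the field.\<close>

lemma CHAR_eq_if_CARD_prime_power:
  assumes "prime p" "CARD('a::{field, finite}) = p ^ n"
  shows "CHAR('a) = p"
proof -
  have "(\<Sum>x\<in>UNIV. x) = (\<Sum>x\<in>UNIV. x + 1 :: 'a)"
    by (rule sum.reindex_bij_witness[of _ "\<lambda>x. x + 1" "\<lambda>x. x - 1"]) auto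
  then have "of_nat CARD('a) = (0 :: 'a)" by (simp add: sum.distrib)
  then have "CHAR('a) dvd p ^ n" by (simp only: of_nat_eq_0_iff_char_dvd assms(2))
  then have "CHAR('a) dvd p" using prime_CHAR_finite_field[where 'a = 'a] prime_dvd_power by blast
  then show ?thesis using prime_CHAR_finite_field[where 'a = 'a] assms(1) by (simp add: primes_dvd_imp_eq)
qed

lemma frobenius_add:
  fixes x y :: "'a::{field, finite}"
  shows "(x + y) ^ (CHAR('a) ^ m) = x ^ (CHAR('a) ^ m) + y ^ (CHAR('a) ^ m)"
  by (rule freshmans_dream') (simp_all add: prime_CHAR_finite_field)

lemma frobenius_diff:
  fixes x y :: "'a::{field, finite}"
  shows "(x - y) ^ (CHAR('a) ^ m) = x ^ (CHAR('a) ^ m) - y ^ (CHAR('a) ^ m)"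
  using frobenius_add[of "x - y" y m] by simp

lemma surj_frobenius: "surj (\<lambda>x :: 'a::{field, finite}. x ^ (CHAR('a) ^ m))"
proof (rule finite_UNIV_inj_surj)
  show "inj (\<lambda>x :: 'a. x ^ (CHAR('a) ^ m))"
  proof (rule injI)
    fix x y :: 'a assume "x ^ (CHAR('a) ^ m) = y ^ (CHAR('a) ^ m)"
    then have "(x - y) ^ (CHAR('a) ^ m) = 0" by (simp add: frobenius_diff)
    then show "x = y" by simp
  qed
qed simp

text \<open>If the denominator vanishes, the numerator does not and both sides are false; otherwise
  the equation is divided by the power of the denominator.\<close>

lemma linear_fractional_root_of_unity_iff:
  fixes a b c d x :: "'a::field"
  assumes "a * d - b * c \<noteq> 0" "k > 0"
  shows "linear_fractional a b c d (Some x) \<in> Some ` {u. u ^ k = 1}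
    \<longleftrightarrow> (a * x + b) ^ k = (c * x + d) ^ k"
proof (cases "c * x + d = 0")
  case True
  then have "a * x + b \<noteq> 0" using linear_map_nonzero[OF assms(1), of x 1] by simp
  then show ?thesis using True assms(2) by (auto simp: power_0_left)
next
  case False
  then show ?thesis by (auto simp: power_divide)
qed

text \<open>With \<open>s = k - 1\<close>, we have \<open>x\<^sup>s = 1 / x\<close> for a \<open>k\<close>-th root of unity \<open>x\<close>, which turns \<open>(a x + b)\<^sup>k = (c x + d)\<^sup>k\<close> into a quadratic equation in \<open>x\<close>.\<close>

lemma roots_of_unity_rigid:
  fixes g :: "'a::{field, finite} option \<Rightarrow> 'a option"
  assumes k: "k = CHAR('a) ^ m + 1" and B: "B = Some ` {u :: 'a. u ^ k = 1}"
    and g: "g \<in> carrier PGL2" and meet: "card (g ` B \<inter> B) \<ge> 3"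
  shows "g ` B = B"
proof -
  define s where "s = CHAR('a) ^ m"
  obtain a b c d where abcd: "g = linear_fractional a b c d" "a * d - b * c \<noteq> 0"
    using g unfolding PGL2_iff by blast
  \<comment> \<open>The difference of the expansions in \<open>quadratic\<close> for the pairs
    \<open>(a, b)\<close> and \<open>(c, d)\<close>. The extra factor \<open>x\<close> there clears
    the inverse, via \<open>x * x ^ s = x ^ k = 1\<close>.\<close>
  define Q where "Q = [:a ^ s * b - c ^ s * d, a ^ s * a + b ^ s * b - c ^ s * c - d ^ s * d,
    b ^ s * a - d ^ s * c:]"
  have quadratic: "e ^ s * f + (e ^ s * e + f ^ s * f) * x + f ^ s * e * x\<^sup>2 = x * (e * x + f) ^ k"
    if "x ^ k = 1" for e f x :: 'a
  proof -
    have "x * (e * x + f) ^ k = x * (e * x + f) ^ s * (e * x + f)"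
      by (simp add: k s_def)
    also have "x * (e * x + f) ^ s = e ^ s * x ^ k + f ^ s * x"
      unfolding s_def frobenius_add by (simp add: k power_mult_distrib algebra_simps)
    also have "(e ^ s * x ^ k + f ^ s * x) * (e * x + f)
        = e ^ s * f + (e ^ s * e + f ^ s * f) * x + f ^ s * e * x\<^sup>2"
      using that by (simp add: algebra_simps power2_eq_square)
    finally show ?thesis by simp
  qed
  have iff: "g (Some x) \<in> B \<longleftrightarrow> poly Q x = 0" if x: "x ^ k = 1" for x
  proof -
    have "poly Q x = x * (a * x + b) ^ k - x * (c * x + d) ^ k"
      unfolding quadratic[OF x, symmetric] by (simp add: Q_def algebra_simps power2_eq_square)
    moreover have "x \<noteq> 0" using x k by auto
    ultimately show ?thesis
      using linear_fractional_root_of_unity_iff[OF abcd(2), of k x]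
      by (simp add: abcd(1) B k flip: right_diff_distrib)
  qed
  have "g ` B \<inter> B \<subseteq> (\<lambda>x. g (Some x)) ` {x. poly Q x = 0}" using iff by (auto simp: B)
  then have "card (g ` B \<inter> B) \<le> card ((\<lambda>x. g (Some x)) ` {x. poly Q x = 0})"
    by (intro card_mono) auto
  also have "\<dots> \<le> card {x. poly Q x = 0}" by (intro card_image_le) simp
  finally have "card {x. poly Q x = 0} > 2" using meet by simp
  moreover have "degree Q \<le> 2" by (simp add: Q_def)
  \<comment> \<open>More than two roots force a polynomial of degree at most 2 to vanish, so every
    point of \<open>B\<close> is mapped into \<open>B\<close>.\<close>
  ultimately have "Q = 0" using card_poly_roots_bound[of Q] by linarith
  then have "g ` B \<subseteq> B" using iff by (auto simp: B)
  moreover have "card (g ` B) = card B" using g by (rule card_image_PGL2)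
  ultimately show ?thesis by (intro card_subset_eq) auto
qed

text \<open>Both sides have degree at most \<open>t\<close>, below the field size, so equality of
  functions is equality of polynomials and may be differentiated. The common factor \<open>t\<close>
  is nonzero in the field and cancels.\<close>

lemma derivative_power_identity:
  fixes a b c d e f l \<mu> :: "'a::{field, finite}"
  assumes id: "\<And>x. e * (a * x + b) ^ t - f * (c * x + d) ^ t = l * x ^ t + \<mu>"
    and t: "t < CARD('a)" "of_nat t \<noteq> (0 :: 'a)"
  shows "e * a * (a * x + b) ^ (t - 1) - f * c * (c * x + d) ^ (t - 1) = l * x ^ (t - 1)"
proof -
  let ?L = "smult e ([:b, a:] ^ t) - smult f ([:d, c:] ^ t)" and ?R = "monom l t + [:\<mu>:]"
  have deg: "degree ([:v, u:] ^ t) \<le> t" for u v :: 'a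
    using degree_power_le[of "[:v, u:]" t] by (simp split: if_splits)
  have "?L = ?R"
  proof (rule poly_eqI_degree[where A = UNIV])
    show "poly ?L x = poly ?R x" for x
      using id[of x] by (simp add: poly_monom algebra_simps)
    have "degree ?L \<le> t" by (intro degree_diff_le order.trans[OF degree_smult_le] deg)
    then show "degree ?L < card (UNIV :: 'a set)" using t by simp
    have "degree ?R \<le> t" by (intro degree_add_le degree_monom_le) simp
    then show "degree ?R < card (UNIV :: 'a set)" using t by simp
  qed
  then have "poly (pderiv ?L) x = poly (pderiv ?R) x" by simp
  then have "of_nat t * (e * a * (a * x + b) ^ (t - 1) - f * c * (c * x + d) ^ (t - 1))
      = of_nat t * (l * x ^ (t - 1))"
    by (simp add: pderiv_diff pderiv_add pderiv_smult pderiv_power pderiv_monom pderiv_pCons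
        poly_monom algebra_simps)
  then show ?thesis using t(2) by simp
qed

text \<open>Substituting \<open>y = x ^ s\<close> leaves an identity of exponent \<open>t\<close>.
  At the root \<open>y\<close> of the first linear form, this identity and its derivative lose their
  first terms; their comparison gives \<open>z = c ^ s * y\<close> for the value \<open>z\<close> of
  the second form, hence \<open>d ^ s = 0\<close>.\<close>

lemma power_identity_degenerate:
  fixes a b c d l :: "'a::{field, finite}"
  assumes det: "a * d - b * c \<noteq> 0" and ac: "a \<noteq> 0" "c \<noteq> 0"
    and s: "s = CHAR('a) ^ m" and t: "t \<ge> 2" "t < CARD('a)" "\<not> CHAR('a) dvd t"
    and id: "\<And>x. a * (a * x + b) ^ (s * t) - c * (c * x + d) ^ (s * t) = l * x ^ (s * t)"
  shows "d = 0"
proof -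
  have s0: "s > 0" using prime_CHAR_finite_field[where 'a = 'a] by (simp add: s prime_gt_0_nat)
  have id_t: "a * (a ^ s * y + b ^ s) ^ t - c * (c ^ s * y + d ^ s) ^ t = l * y ^ t + 0" for y
  proof -
    obtain x where y: "y = x ^ s" using surj_frobenius[where 'a = 'a, of m] unfolding s by blast
    show ?thesis using id[of x] by (simp add: power_mult y s frobenius_add power_mult_distrib)
  qed
  have id_t': "a * a ^ s * (a ^ s * y + b ^ s) ^ (t - 1) - c * c ^ s * (c ^ s * y + d ^ s) ^ (t - 1)
      = l * y ^ (t - 1)" for y
    using id_t t by (intro derivative_power_identity) (simp_all add: of_nat_eq_0_iff_char_dvd)
  define y where "y = - (b ^ s) / a ^ s"
  define z where "z = c ^ s * y + d ^ s"
  have y: "a ^ s * y + b ^ s = 0" using ac by (simp add: y_def)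
  have "a ^ s * z = (a * d - b * c) ^ s"
    unfolding s frobenius_diff using ac by (simp add: z_def y_def s field_simps power_mult_distrib)
  then have z: "z \<noteq> 0" using det s0 by auto
  \<comment> \<open>Since \<open>t \<ge> 2\<close>, the exponent \<open>t - 1\<close> is positive,
    so the first term vanishes at the root in the derived identity too.\<close>
  obtain t' where t': "t = Suc (Suc t')" using t(1) by (metis add_2_eq_Suc le_Suc_ex)
  have "- c * z ^ t = l * y ^ t" "- c * c ^ s * z ^ (t - 1) = l * y ^ (t - 1)"
    using id_t[of y] id_t'[of y] y by (simp_all add: z_def t')
  then have 1: "- c * z ^ (t - 1) * z = l * y ^ (t - 1) * y" and
    2: "- c * c ^ s * z ^ (t - 1) = l * y ^ (t - 1)" by (simp_all add: t' algebra_simps)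
  have "c * z ^ (t - 1) * (z - c ^ s * y) = 0"
    using 1 unfolding 2[symmetric] by (simp add: algebra_simps)
  then have "z = c ^ s * y" using ac z by simp
  then show ?thesis using s0 by (simp add: z_def)
qed

text \<open>The polynomial \<open>(a X + b) ^ k - (c X + d) ^ k\<close> vanishes at all
  \<open>k\<close> roots of unity, so it is a multiple of \<open>X ^ k - 1\<close>. Its derivative
  has exponent \<open>k - 1 = s * t\<close>, as required by
  \<open>power_identity_degenerate\<close>.\<close>

lemma preserving_roots_of_unity:
  fixes a b c d :: "'a::{field, finite}"
  assumes det: "a * d - b * c \<noteq> 0" and card: "card {u :: 'a. u ^ k = 1} = k"
    and k: "k < CARD('a)" "\<not> CHAR('a) dvd k" "k - 1 = CHAR('a) ^ m * t" "t \<ge> 2" "\<not> CHAR('a) dvd t"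
    and maps: "\<And>u. u ^ k = 1 \<Longrightarrow> linear_fractional a b c d (Some u) \<in> Some ` {u. u ^ k = 1}"
  shows "a = 0 \<and> d = 0 \<or> b = 0 \<and> c = 0"
proof -
  define s where "s = CHAR('a) ^ m"
  have k0: "k > 0" using k(2) by (cases k) auto
  let ?L = "[:b, a:] ^ k - [:d, c:] ^ k" and ?R = "monom (a ^ k - c ^ k) k + [:- (a ^ k - c ^ k):]"
  have deg: "degree ([:v, u:] ^ k) \<le> k" for u v :: 'a
    using degree_power_le[of "[:v, u:]" k] by (simp split: if_splits)
  have "?L = ?R"
  \<comment> \<open>Agreement at only \<open>k\<close> points suffices for degree at most
    \<open>k\<close> because the coefficients of \<open>X ^ k\<close> also agree.\<close>
  proof (rule poly_eqI_degree_lead_coeff[where n = k and A = "{u. u ^ k = 1}"])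
    have "poly.coeff ([:v, u:] ^ k) k = u ^ k" for u v :: 'a
    proof (cases "u = 0")
      case True
      then show ?thesis using k0 by (cases k) (simp_all add: power_0_left poly_const_pow del: power_Suc)
    next
      case False
      then have "degree ([:v, u:] ^ k) = k" by (simp add: degree_power_eq)
      then show ?thesis using lead_coeff_power[of "[:v, u:]" k] False by simp
    qed
    then show "poly.coeff ?L k = poly.coeff ?R k" using k0 by (cases k) (simp_all del: power_Suc)
    show "degree ?L \<le> k" by (intro degree_diff_le deg)
    show "degree ?R \<le> k" by (intro degree_add_le degree_monom_le) simp
    show "poly ?L z = poly ?R z" if "z \<in> {u. u ^ k = 1}" for z
      using maps[of z] that linear_fractional_root_of_unity_iff[OF det k0, of z]
      by (simp add: poly_monom algebra_simps)
  qed (simp add: card)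
  then have poly_eq: "poly ?L x = poly ?R x" for x by simp
  have "1 * (a * x + b) ^ k - 1 * (c * x + d) ^ k = (a ^ k - c ^ k) * x ^ k + - (a ^ k - c ^ k)" for x
    using poly_eq[of x] by (simp add: poly_monom algebra_simps)
  from derivative_power_identity[OF this] k
  have id: "a * (a * x + b) ^ (s * t) - c * (c * x + d) ^ (s * t) = (a ^ k - c ^ k) * x ^ (s * t)" for x
    by (simp add: of_nat_eq_0_iff_char_dvd s_def)
  have id': "c * (c * x + d) ^ (s * t) - a * (a * x + b) ^ (s * t) = (c ^ k - a ^ k) * x ^ (s * t)" for x
    using id[of x] by (simp add: algebra_simps)
  have st: "s * t > 0" using k prime_CHAR_finite_field[where 'a = 'a] by (simp add: s_def prime_gt_0_nat)
  have "t \<le> s * t" using st by simp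
  then have t: "t < CARD('a)" using k unfolding s_def by linarith
  \<comment> \<open>If \<open>a\<close> or \<open>c\<close> is 0, evaluating \<open>id\<close> at 0
    suffices. If neither is, applying the degeneration lemma to both orders of the two forms gives
    \<open>b = d = 0\<close>, against the determinant.\<close>
  consider "a = 0" | "c = 0" | "a \<noteq> 0" "c \<noteq> 0" by blast
  then show ?thesis
  proof cases
    case 1
    then show ?thesis using id[of 0] det st by (simp add: power_0_left)
  next
    case 2
    then show ?thesis using id[of 0] det st by (simp add: power_0_left)
  next
    case 3
    have "d = 0" by (rule power_identity_degenerate[OF det 3 s_def k(4) t k(5) id])
    moreover have "c * b - d * a \<noteq> 0" using det by (simp add: algebra_simps)
    from power_identity_degenerate[OF this 3(2,1) s_def k(4) t k(5) id'] have "b = 0" .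
    ultimately show ?thesis using det by simp
  qed
qed

text \<open>The stabilizer consists of the maps \<open>x \<mapsto> u * x\<close> and
  \<open>x \<mapsto> u / x\<close> with \<open>u ^ k = 1\<close>. The two families differ at
  \<infinity>, and in each one \<open>u\<close> is the image of 1.\<close>

lemma card_stabilizer_roots_of_unity:
  fixes B :: "'a::{field, finite} option set"
  assumes B: "B = Some ` {u :: 'a. u ^ k = 1}" and card: "card {u :: 'a. u ^ k = 1} = k"
    and k: "k < CARD('a)" "\<not> CHAR('a) dvd k" "k - 1 = CHAR('a) ^ m * t" "t \<ge> 2" "\<not> CHAR('a) dvd t"
  shows "card {g \<in> carrier PGL2. g ` B = B} = 2 * k"
proof -
  let ?U = "{u :: 'a. u ^ k = 1}"
  let ?D = "(\<lambda>u. linear_fractional u 0 0 1) ` ?U" and ?A = "(\<lambda>u. linear_fractional 0 u 1 0) ` ?U"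
  have k0: "k > 0" using k(2) by (cases k) auto
  have nz: "u \<noteq> 0" if "u \<in> ?U" for u using that k0 by (auto simp: power_0_left)
  have "{g \<in> carrier PGL2. g ` B = B} = ?D \<union> ?A"
  proof (intro equalityI subsetI)
    fix g :: "'a option \<Rightarrow> 'a option" assume g: "g \<in> {g \<in> carrier PGL2. g ` B = B}"
    then obtain a b c d where abcd: "g = linear_fractional a b c d" "a * d - b * c \<noteq> 0"
      unfolding PGL2_iff by blast
    have maps: "linear_fractional a b c d (Some u) \<in> Some ` ?U" if "u ^ k = 1" for u
    proof -
      have "g (Some u) \<in> g ` B" using that by (auto simp: B)
      then show ?thesis using g by (simp add: abcd(1) B)
    qed
    \<comment> \<open>The image of 1 is the normalized entry \<open>b / c\<close> or
      \<open>a / d\<close>, which is therefore a root of unity.\<close>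
    have one: "linear_fractional a b c d (Some 1) \<in> Some ` ?U" using maps[of 1] by simp
    from preserving_roots_of_unity[OF abcd(2) card k maps]
    show "g \<in> ?D \<union> ?A"
    proof
      assume *: "a = 0 \<and> d = 0"
      then have "c \<noteq> 0" using abcd(2) by auto
      have "g = linear_fractional 0 (b / c) 1 0"
      proof
        fix z show "g z = linear_fractional 0 (b / c) 1 0 z"
          using * \<open>c \<noteq> 0\<close> unfolding abcd(1) by (cases z) auto
      qed
      moreover have "b / c \<in> ?U" using one * \<open>c \<noteq> 0\<close> by auto
      ultimately show ?thesis by blast
    next
      assume *: "b = 0 \<and> c = 0"
      then have "d \<noteq> 0" using abcd(2) by auto
      have "g = linear_fractional (a / d) 0 0 1"
      proof
        fix z show "g z = linear_fractional (a / d) 0 0 1 z"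
          using * \<open>d \<noteq> 0\<close> unfolding abcd(1) by (cases z) auto
      qed
      moreover have "a / d \<in> ?U" using one * \<open>d \<noteq> 0\<close> by auto
      ultimately show ?thesis by blast
    qed
  next
    fix g :: "'a option \<Rightarrow> 'a option" assume g: "g \<in> ?D \<union> ?A"
    then have "g \<in> carrier PGL2" using nz by (auto intro!: linear_fractional_in_PGL2)
    moreover have "g ` B \<subseteq> B"
      using g nz by (auto simp: B power_mult_distrib power_divide)
    moreover have "card (g ` B) = card B" using \<open>g \<in> carrier PGL2\<close> by (rule card_image_PGL2)
    ultimately show "g \<in> {g \<in> carrier PGL2. g ` B = B}" using card_subset_eq[of B "g ` B"] by simp
  qed
  moreover have "?D \<inter> ?A = {}"
  proof -
    have "linear_fractional u 0 0 1 None \<noteq> linear_fractional 0 v 1 0 None" for u v :: 'a by simp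
    then show ?thesis by (metis (no_types, lifting) disjoint_iff imageE)
  qed
  moreover have "card ?D = k"
    using card by (subst card_image) (auto intro!: inj_onI dest!: fun_cong[where x = "Some 1"])
  moreover have "card ?A = k"
    using card by (subst card_image) (auto intro!: inj_onI dest!: fun_cong[where x = "Some 1"])
  ultimately show ?thesis by (simp add: card_Un_disjoint)
qed

section \<open>The orbit design\<close>

text \<open>Multiplication by \<open>x\<close> permutes the nonzero elements, so it preserves their
  nonzero product.\<close>

lemma power_CARD_minus_1:
  fixes x :: "'a::{field, finite}"
  assumes "x \<noteq> 0"
  shows "x ^ (CARD('a) - 1) = 1"
proof -
  have "(\<Prod>y\<in>UNIV - {0}. x * y) = \<Prod>(UNIV - {0})"
    by (rule prod.reindex_bij_witness[of _ "\<lambda>y. y / x" "\<lambda>y. x * y"]) (use assms in auto)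
  moreover have "(\<Prod>y\<in>UNIV - {0}. x * y) = x ^ (CARD('a) - 1) * \<Prod>(UNIV - {0})"
    by (simp add: prod.distrib)
  moreover have "\<Prod>(UNIV - {0 :: 'a}) \<noteq> 0" by simp
  ultimately show ?thesis by simp
qed

lemma card_roots_le:
  fixes c :: "'a::{field, finite}"
  assumes "n > 0"
  shows "card {x. x ^ n = c} \<le> n"
proof -
  let ?P = "monom 1 n - [:c:]"
  have "poly.coeff ?P n = 1" using assms by (cases n) auto
  then have "?P \<noteq> 0" by (metis coeff_0 zero_neq_one)
  then have "card {x. poly ?P x = 0} \<le> degree ?P" by (rule card_poly_roots_bound)
  also have "\<dots> \<le> n" by (intro degree_diff_le degree_monom_le) simp
  finally show ?thesis by (simp add: poly_monom)
qed

text \<open>The map \<open>x \<mapsto> x\<^sup>r\<close> sends the \<open>k r\<close> units onto the subgroup generated by \<open>\<theta>\<^sup>r\<close> with fibres of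
  size at most \<open>r\<close>, so this subgroup has at least \<open>k\<close> elements.\<close>

lemma cyclic_subgroup_eq_roots_of_unity:
  fixes \<theta> :: "'a::{field, finite}"
  assumes prim: "primitive_element \<theta>" and card: "CARD('a) - 1 = k * r" and pos: "k > 0" "r > 0"
  shows "cyclic_subgroup (\<theta> ^ r) = {u. u ^ k = 1}" "card {u :: 'a. u ^ k = 1} = k"
proof -
  let ?C = "cyclic_subgroup (\<theta> ^ r)" and ?U = "{u :: 'a. u ^ k = 1}"
  have units: "cyclic_subgroup \<theta> = UNIV - {0}" using prim by (simp add: primitive_element_def)
  have C: "?C = (\<lambda>x. x ^ r) ` (UNIV - {0})"
  proof -
    have "(\<theta> ^ r) powi i = (\<theta> powi i) ^ r" for i
      by (metis mult.commute power_int_mult power_int_of_nat)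
    then show ?thesis unfolding units[symmetric] by (auto simp: cyclic_subgroup_def)
  qed
  have sub: "?C \<subseteq> ?U"
    using power_CARD_minus_1[where 'a = 'a] card by (auto simp: C mult.commute simp flip: power_mult)
  have "k * r = card (UNIV - {0 :: 'a})" using card by simp
  also have "\<dots> = (\<Sum>x\<in>UNIV - {0 :: 'a}. 1)" by simp
  also have "\<dots> = (\<Sum>c\<in>?C. \<Sum>x\<in>{x \<in> UNIV - {0}. x ^ r = c}. 1)"
    by (rule sum.group[symmetric]) (auto simp: C)
  also have "\<dots> \<le> (\<Sum>c\<in>?C. r)"
  proof (rule sum_mono)
    fix c :: 'a
    have "card {x \<in> UNIV - {0}. x ^ r = c} \<le> card {x. x ^ r = c}" by (rule card_mono) auto
    then show "(\<Sum>x\<in>{x \<in> UNIV - {0}. x ^ r = c}. 1) \<le> r"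
      using card_roots_le[OF pos(2), of c] by simp
  qed
  finally have "k \<le> card ?C" using pos(2) by simp
  moreover have "card ?C \<le> card ?U" using sub by (intro card_mono) auto
  moreover have "card ?U \<le> k" using pos(1) by (rule card_roots_le)
  ultimately have "card ?C = k" "card ?U = k" by auto
  then show "card ?U = k" "?C = ?U" using sub by (simp_all add: card_subset_eq)
qed

theorem theorem3:
  fixes p n q k r :: nat and \<theta> :: "'a::{field, finite}" and B :: "'a option set"
    and \<B> :: "'a option set multiset"
  assumes "prime p" and "q = p ^ n" and "CARD('a) = q"
    and "primitive_element \<theta>"
    and "k \<ge> 4" and "r \<ge> 1" and "q - 1 = k * r"
    and "B = Some ` cyclic_subgroup (\<theta> ^ r)"
    and "\<B> = mset_set (orbit PGL2 (\<lambda>g. (`) g) B)"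
  shows "is_3_design (q + 1) k (if k - 1 dvd q then 1 else (k - 1) * (k - 2) div 2) UNIV \<B>
         \<and> simple_design \<B>"
proof -
  let ?O = "orbit PGL2 (\<lambda>g. (`) g) B"
  have CHAR: "CHAR('a) = p" using assms(1-3) by (intro CHAR_eq_if_CARD_prime_power) auto
  have k_le: "k \<le> q - 1" using assms(6,7) by simp
  then have kq: "k < q" using assms(5) by linarith
  have B: "B = Some ` {u. u ^ k = 1}" and card_U: "card {u :: 'a. u ^ k = 1} = k"
    using cyclic_subgroup_eq_roots_of_unity[OF assms(4), of k r] assms by auto
  have card_B: "card B = k" using card_U by (simp add: B card_image)
  \<comment> \<open>Otherwise \<open>p\<close> would divide both \<open>q\<close> and
    \<open>q - 1\<close>.\<close>
  have pk: "\<not> p dvd k"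
  proof
    assume "p dvd k"
    then have "p dvd q - 1" using assms(7) by simp
    moreover have "p dvd q" using assms(2) kq assms(5) by (cases n) auto
    ultimately have "p dvd q - (q - 1)" by (rule dvd_diff_nat[rotated])
    then show False using assms(1) kq by simp
  qed
  have count: "card {b \<in> ?O. T \<subseteq> b} = (if k - 1 dvd q then 1 else (k - 1) * (k - 2) div 2)"
    if T: "card T = 3" for T
  proof (cases "k - 1 dvd q")
    case True
    \<comment> \<open>A divisor of a power of \<open>p\<close> is itself a power of
      \<open>p\<close>, so this is the rigid case.\<close>
    then obtain m where "k - 1 = p ^ m" using assms(1,2) divides_primepow_nat by blast
    then have "k = CHAR('a) ^ m + 1" using assms(5) CHAR by simp
    then have "card {b \<in> ?O. T \<subseteq> b} = 1"
      using assms(5) card_B by (intro card_blocks_eq_1[OF T] roots_of_unity_rigid[OF _ B]) auto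
    then show ?thesis using True by simp
  next
    case False
    have "k - 1 \<noteq> 0" "\<not> is_unit p" using assms(1,5) not_prime_unit by auto
    then obtain t where t: "k - 1 = p ^ multiplicity p (k - 1) * t" "\<not> p dvd t"
      using multiplicity_decompose'[of "k - 1" p] by blast
    define m where "m = multiplicity p (k - 1)"
    have km: "k - 1 = p ^ m * t" using t(1) by (simp add: m_def)
    \<comment> \<open>With \<open>t = 1\<close>, \<open>k - 1\<close> would be a power of
      \<open>p\<close> below \<open>p ^ n\<close>, hence a divisor of \<open>q\<close>.\<close>
    have "t \<noteq> 1"
    proof
      assume "t = 1"
      then have "p ^ m < p ^ n" using km kq assms(2) by simp
      then have "m \<le> n" using assms(1) by (meson nat_less_le not_le power_increasing prime_ge_1_nat)
      then have "k - 1 dvd q" using km \<open>t = 1\<close> assms(2) by (simp add: le_imp_power_dvd)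
      then show False using False by simp
    qed
    moreover have "t \<noteq> 0" using t(2) by (metis dvd_0_right)
    ultimately have "t \<ge> 2" by simp
    then have "card {g \<in> carrier PGL2. g ` B = B} = 2 * k"
      using card_stabilizer_roots_of_unity[OF B card_U, of m t] kq pk km t(2) assms(3) CHAR by simp
    \<comment> \<open>The stabilizer has order \<open>2 * k\<close>; cancelling \<open>k\<close> in
      the double count leaves twice the number of blocks.\<close>
    then have "k * (2 * card {b \<in> ?O. T \<subseteq> b}) = k * ((k - 1) * (k - 2))"
      using card_blocks_times_stabilizer[OF T, of B] card_B assms(5) by (simp add: algebra_simps)
    then have "2 * card {b \<in> ?O. T \<subseteq> b} = (k - 1) * (k - 2)" using assms(5) by simp
    then have "card {b \<in> ?O. T \<subseteq> b} = (k - 1) * (k - 2) div 2" by linarith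
    then show ?thesis using False by simp
  qed
  have "card (UNIV :: 'a option set) = q + 1" using assms(3) by (simp add: card_UNIV_option)
  moreover have "card b = k" if "b \<in># \<B>" for b
    using that by (auto simp: assms(9) card_B orbit_PGL2_iff card_image_PGL2)
  moreover have "size {#b \<in># \<B>. T \<subseteq> b#} = card {b \<in> ?O. T \<subseteq> b}" for T
    by (simp add: assms(9) filter_mset_mset_set)
  ultimately have "is_3_design (q + 1) k (if k - 1 dvd q then 1 else (k - 1) * (k - 2) div 2) UNIV \<B>"
    using count unfolding is_3_design_def by simp
  moreover have "simple_design \<B>"
    by (simp add: simple_design_def assms(9) count_mset_set')
  ultimately show ?thesis by simp
qed

end
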